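(* Let $I$ be a database instance, $F$ a finite set of denial constraints, and $\succ$ a priority of $I$ w.r.t. $F$ (in particular $\succ$ is acyclic). For two repairs $I_1',I_2'$ of $I$ w.r.t. $F$, say that $I_1'$ Pareto dominates $I_2'$, written $I_1'\gg_{\mathcal P} I_2'$, if $$\exists y\in I_1'\setminus I_2'.\ \forall x\in I_2'\setminus I_1'.\ y\succ x.$$ Then: (i) a repair $I'$ of $I$ w.r.t. $F$ is Pareto optimal w.r.t. $\succ$ and $F$ if and only if there is no repair $I''\neq I'$ of $I$ w.r.t. $F$ such that $I''\gg_{\mathcal P} I'$; (ii) $\gg_{\mathcal P}$ is acyclic.
   Context: A database schema is a set of relation names of fixed positive arity; each attribute ranges over one of two disjoint infinite domains: the rationals $\mathbb{Q}$ (with built-in predicates $=,\neq,<,\le,>,\ge$) or a set $D$ of uninterpreted constants (with built-in predicates $=,\neq$). A fact is an expression $R(t)$ with $R$ a relation name and $t$ a tuple of constants of the right arity and types. A database instance is a finite set of facts. A denial constraint is a sentence $\forall\bar x.\ \neg[R_1(\bar x_1)\wedge\dots\wedge R_n(\bar x_n)\wedge\varphi(\bar x)]$ with $n>0$, $\bar x_1\cup\dots\cup\bar x_n=\bar x$, and $\varphi$ a quantifier-free formula using only built-in predicates. A set of facts $\{R_1(t_1),\dots,R_n(t_n)\}\subseteq I$ is a conflict in $I$ w.r.t. $F$ if for some denial constraint $\forall\bar x.\ \neg[R_1(\bar x_1)\wedge\dots\wedge R_n(\bar x_n)\wedge\varphi(\bar x)]$ in $F$ there is a substitution $\rho$ of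 constants for $\bar x$ such that $\varphi(\rho(\bar x))$ is true and $\rho(\bar x_i)=t_i$ for all $i$; an instance is consistent with $F$ iff it satisfies $F$, i.e. iff it contains no conflict. A repair of $I$ w.r.t. $F$ is a maximal (under inclusion) subset of $I$ consistent with $F$. Two facts of $I$ are neighbors if some conflict contains both. A priority of $I$ w.r.t. $F$ is an acyclic binary relation $\succ$ on $I$ such that $x\succ y$ implies that $x$ and $y$ are neighbors. A set $I'\subseteq I$ is Pareto optimal w.r.t. $\succ$ and $F$ if there are no nonempty $X\subseteq I'$ and nonempty $Y\subseteq I\setminus I'$ such that $\forall x\in X.\ \forall y\in Y.\ y\succ x$ and $(I'\setminus X)\cup Y$ is consistent with $F$. *)

theory Defs
  imports "HOL-Library.Infinite_Typeclass"
begin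

datatype domain = Rational | Uninterpreted

text \<open>The disjoint union of the rationals and the set of uninterpreted constants, the latter
  being the universe of the (infinite) type \<open>'d\<close>.\<close>

datatype 'd const = RatC rat | UninC 'd

fun domain_of :: "'d const \<Rightarrow> domain" where
  "domain_of (RatC q) = Rational"
| "domain_of (UninC d) = Uninterpreted"

text \<open>A schema maps each of its relation names to the list of the domains of its attributes; the
  relation names are the elements of \<open>dom S\<close>.\<close>

type_synonym 'r schema = "'r \<rightharpoonup> domain list"

definition is_schema :: "'r schema \<Rightarrow> bool" where
  "is_schema S \<longleftrightarrow> (\<forall>ds \<in> ran S. ds \<noteq> [])"

type_synonym ('r, 'd) fact = "'r \<times> 'd const list"

definition is_fact :: "'r schema \<Rightarrow> ('r, 'd) fact \<Rightarrow> bool" where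
  "is_fact S f \<longleftrightarrow> S (fst f) = Some (map domain_of (snd f))"

definition is_instance :: "'r schema \<Rightarrow> ('r, 'd) fact set \<Rightarrow> bool" where
  "is_instance S I \<longleftrightarrow> finite I \<and> (\<forall>f \<in> I. is_fact S f)"

type_synonym var = nat

datatype 'd trm = Var var | Const "'d const"

datatype builtin = Eq | Neq | Less | LessEq | Greater | GreaterEq

datatype 'd qf_formula =
    Builtin builtin "'d trm" "'d trm"
  | Neg "'d qf_formula"
  | Conj "'d qf_formula" "'d qf_formula"
  | Disj "'d qf_formula" "'d qf_formula"

fun trm_vars :: "'d trm \<Rightarrow> var set" where
  "trm_vars (Var x) = {x}"
| "trm_vars (Const c) = {}"

fun formula_vars :: "'d qf_formula \<Rightarrow> var set" where
  "formula_vars (Builtin p s t) = trm_vars s \<union> trm_vars t"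
| "formula_vars (Neg \<phi>) = formula_vars \<phi>"
| "formula_vars (Conj \<phi> \<psi>) = formula_vars \<phi> \<union> formula_vars \<psi>"
| "formula_vars (Disj \<phi> \<psi>) = formula_vars \<phi> \<union> formula_vars \<psi>"

fun trm_domain :: "(var \<Rightarrow> domain) \<Rightarrow> 'd trm \<Rightarrow> domain" where
  "trm_domain \<tau> (Var x) = \<tau> x"
| "trm_domain \<tau> (Const c) = domain_of c"

text \<open>Equality and disequality relate terms of the same domain; the order predicates are available
  on the rationals only.\<close>

fun well_typed :: "(var \<Rightarrow> domain) \<Rightarrow> 'd qf_formula \<Rightarrow> bool" where
  "well_typed \<tau> (Builtin p s t) \<longleftrightarrow>
     trm_domain \<tau> s = trm_domain \<tau> t \<and> (p \<notin> {Eq, Neq} \<longrightarrow> trm_domain \<tau> s = Rational)"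
| "well_typed \<tau> (Neg \<phi>) \<longleftrightarrow> well_typed \<tau> \<phi>"
| "well_typed \<tau> (Conj \<phi> \<psi>) \<longleftrightarrow> well_typed \<tau> \<phi> \<and> well_typed \<tau> \<psi>"
| "well_typed \<tau> (Disj \<phi> \<psi>) \<longleftrightarrow> well_typed \<tau> \<phi> \<and> well_typed \<tau> \<psi>"

fun trm_val :: "(var \<Rightarrow> 'd const) \<Rightarrow> 'd trm \<Rightarrow> 'd const" where
  "trm_val \<rho> (Var x) = \<rho> x"
| "trm_val \<rho> (Const c) = c"

text \<open>The value of an order predicate outside the rationals is immaterial, as it does not occur in
  the evaluation of well-typed formulas.\<close>

fun on_rationals :: "(rat \<Rightarrow> rat \<Rightarrow> bool) \<Rightarrow> 'd const \<Rightarrow> 'd const \<Rightarrow> bool" where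
  "on_rationals r (RatC p) (RatC q) \<longleftrightarrow> r p q"
| "on_rationals r _ _ \<longleftrightarrow> False"

fun builtin_holds :: "builtin \<Rightarrow> 'd const \<Rightarrow> 'd const \<Rightarrow> bool" where
  "builtin_holds Eq a b \<longleftrightarrow> a = b"
| "builtin_holds Neq a b \<longleftrightarrow> a \<noteq> b"
| "builtin_holds Less a b \<longleftrightarrow> on_rationals (<) a b"
| "builtin_holds LessEq a b \<longleftrightarrow> on_rationals (\<le>) a b"
| "builtin_holds Greater a b \<longleftrightarrow> on_rationals (>) a b"
| "builtin_holds GreaterEq a b \<longleftrightarrow> on_rationals (\<ge>) a b"

fun formula_holds :: "(var \<Rightarrow> 'd const) \<Rightarrow> 'd qf_formula \<Rightarrow> bool" where
  "formula_holds \<rho> (Builtin p s t) \<longleftrightarrow> builtin_holds p (trm_val \<rho> s) (trm_val \<rho> t)"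
| "formula_holds \<rho> (Neg \<phi>) \<longleftrightarrow> \<not> formula_holds \<rho> \<phi>"
| "formula_holds \<rho> (Conj \<phi> \<psi>) \<longleftrightarrow> formula_holds \<rho> \<phi> \<and> formula_holds \<rho> \<psi>"
| "formula_holds \<rho> (Disj \<phi> \<psi>) \<longleftrightarrow> formula_holds \<rho> \<phi> \<or> formula_holds \<rho> \<psi>"

text \<open>\<open>Denial [(R\<^sub>1, xs\<^sub>1), \<dots>, (R\<^sub>n, xs\<^sub>n)] \<phi>\<close> stands for
  \<open>\<forall>x. \<not> (R\<^sub>1(xs\<^sub>1) \<and> \<dots> \<and> R\<^sub>n(xs\<^sub>n) \<and> \<phi>(x))\<close>, where \<open>x\<close> consists of the variables of the
  \<open>xs\<^sub>i\<close>.\<close>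

datatype ('r, 'd) denial = Denial (atoms: "('r \<times> var list) list") (cond: "'d qf_formula")

definition is_denial :: "'r schema \<Rightarrow> ('r, 'd) denial \<Rightarrow> bool" where
  "is_denial S c \<longleftrightarrow>
     atoms c \<noteq> [] \<and>
     formula_vars (cond c) \<subseteq> (\<Union>(R, xs) \<in> set (atoms c). set xs) \<and>
     (\<exists>\<tau>. (\<forall>(R, xs) \<in> set (atoms c). S R = Some (map \<tau> xs)) \<and> well_typed \<tau> (cond c))"

text \<open>Substitutions are total functions not required to respect the domains of the variables:
  for the variables of a denial constraint this is forced as soon as all the atoms are mapped to
  facts of an instance, and the values of other variables are irrelevant.\<close>

definition atom_facts ::
    "(var \<Rightarrow> 'd const) \<Rightarrow> ('r, 'd) denial \<Rightarrow> ('r, 'd) fact set" where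
  "atom_facts \<rho> c = (\<lambda>(R, xs). (R, map \<rho> xs)) ` set (atoms c)"

definition satisfies :: "('r, 'd) fact set \<Rightarrow> ('r, 'd) denial \<Rightarrow> bool" where
  "satisfies I c \<longleftrightarrow>
     (\<forall>\<rho>. \<not> ((\<forall>(R, xs) \<in> set (atoms c). (R, map \<rho> xs) \<in> I) \<and> formula_holds \<rho> (cond c)))"

definition consistent :: "('r, 'd) denial set \<Rightarrow> ('r, 'd) fact set \<Rightarrow> bool" where
  "consistent F I \<longleftrightarrow> (\<forall>c \<in> F. satisfies I c)"

definition conflict ::
    "('r, 'd) fact set \<Rightarrow> ('r, 'd) denial set \<Rightarrow> ('r, 'd) fact set \<Rightarrow> bool" where
  "conflict I F C \<longleftrightarrow>
     C \<subseteq> I \<and> (\<exists>c \<in> F. \<exists>\<rho>. C = atom_facts \<rho> c \<and> formula_holds \<rho> (cond c))"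

lemma atom_facts_subset_iff:
  "atom_facts \<rho> c \<subseteq> I \<longleftrightarrow> (\<forall>(R, xs) \<in> set (atoms c). (R, map \<rho> xs) \<in> I)"
  by (simp only: atom_facts_def image_subset_iff case_prod_unfold)

lemma consistent_iff_no_conflict: "consistent F I \<longleftrightarrow> (\<nexists>C. conflict I F C)"
  unfolding consistent_def satisfies_def conflict_def atom_facts_subset_iff [symmetric] by blast

definition repair ::
    "('r, 'd) fact set \<Rightarrow> ('r, 'd) denial set \<Rightarrow> ('r, 'd) fact set \<Rightarrow> bool" where
  "repair I F I' \<longleftrightarrow>
     I' \<subseteq> I \<and> consistent F I' \<and> (\<forall>J. I' \<subseteq> J \<and> J \<subseteq> I \<and> consistent F J \<longrightarrow> J = I')"

definition neighbors ::
    "('r, 'd) fact set \<Rightarrow> ('r, 'd) denial set \<Rightarrow> ('r, 'd) fact \<Rightarrow> ('r, 'd) fact \<Rightarrow> bool" where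
  "neighbors I F x y \<longleftrightarrow> (\<exists>C. conflict I F C \<and> x \<in> C \<and> y \<in> C)"

text \<open>Here and below, \<open>(x, y) \<in> P\<close> stands for \<open>x \<succ> y\<close>.\<close>

definition priority ::
    "('r, 'd) fact set \<Rightarrow> ('r, 'd) denial set \<Rightarrow> ('r, 'd) fact rel \<Rightarrow> bool" where
  "priority I F P \<longleftrightarrow> P \<subseteq> I \<times> I \<and> acyclic P \<and> (\<forall>(x, y) \<in> P. neighbors I F x y)"

definition pareto_optimal ::
    "('r, 'd) fact set \<Rightarrow> ('r, 'd) denial set \<Rightarrow> ('r, 'd) fact rel \<Rightarrow> ('r, 'd) fact set \<Rightarrow> bool" where
  "pareto_optimal I F P I' \<longleftrightarrow>
     I' \<subseteq> I \<and>
     \<not> (\<exists>X Y. X \<noteq> {} \<and> X \<subseteq> I' \<and> Y \<noteq> {} \<and> Y \<subseteq> I - I' \<and>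
          (\<forall>x \<in> X. \<forall>y \<in> Y. (y, x) \<in> P) \<and> consistent F ((I' - X) \<union> Y))"

definition pareto_dominates ::
    "('r, 'd) fact set \<Rightarrow> ('r, 'd) denial set \<Rightarrow> ('r, 'd) fact rel \<Rightarrow> ('r, 'd) fact set rel" where
  "pareto_dominates I F P =
     {(I1, I2). repair I F I1 \<and> repair I F I2 \<and> (\<exists>y \<in> I1 - I2. \<forall>x \<in> I2 - I1. (y, x) \<in> P)}"

end

theory Submission
  imports Defs
begin

text \<open>Only two properties of denial constraints matter: consistency is inherited by subsets, and in a
  finite instance every consistent subset extends to a repair. For acyclicity, let \<open>y\<^sub>i\<close> witness the
  \<open>i\<close>-th step of a cycle of repairs. Since \<open>y\<^sub>i\<close> is lost in step \<open>i\<close>, it has to be regained in some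
  step \<open>j\<close> of the cycle, whence \<open>y\<^sub>j \<succ> y\<^sub>i\<close>. So no \<open>y\<^sub>i\<close> is maximal for \<open>\<succ>\<close>, which is impossible for an
  acyclic relation on a finite set.\<close>

lemma consistent_subset:
  assumes "consistent F J" and "K \<subseteq> J"
  shows "consistent F K"
  using assms unfolding consistent_iff_no_conflict conflict_def by blast

lemma consistent_extends_to_repair:
  assumes "finite I" and "J \<subseteq> I" and "consistent F J"
  obtains K where "J \<subseteq> K" and "repair I F K"
proof -
  let ?E = "{K. K \<subseteq> I \<and> consistent F K}"
  have "finite ?E"
    using assms(1) by simp
  then obtain K where "K \<in> ?E" "J \<subseteq> K" "\<forall>L \<in> ?E. K \<subseteq> L \<longrightarrow> K = L"
    using finite_has_maximal2[of ?E J] assms(2,3) by auto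
  then have "repair I F K"
    unfolding repair_def by blast
  with \<open>J \<subseteq> K\<close> show thesis by (rule that)
qed

text \<open>A dominating repair \<open>I''\<close> with witness \<open>y\<close> is the exchange of
  \<open>X = I' - I''\<close> for \<open>Y = {y}\<close>. Conversely, the result of an exchange
  extends to a repair, and any element of \<open>Y\<close> witnesses that it dominates
  \<open>I'\<close>.\<close>

lemma pareto_optimal_repair_iff:
  assumes "finite I" and rep: "repair I F I'"
  shows "pareto_optimal I F P I' \<longleftrightarrow> (\<nexists>I''. (I'', I') \<in> pareto_dominates I F P)"
proof
  assume opt: "pareto_optimal I F P I'"
  show "\<nexists>I''. (I'', I') \<in> pareto_dominates I F P"
  proof
    assume "\<exists>I''. (I'', I') \<in> pareto_dominates I F P"
    then obtain I'' y where I'': "repair I F I''" and y: "y \<in> I'' - I'"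
      and dom: "\<forall>x \<in> I' - I''. (y, x) \<in> P"
      unfolding pareto_dominates_def by blast
    have I''_props: "I'' \<subseteq> I" "consistent F I''"
      using I'' unfolding repair_def by auto
    \<comment> \<open>Otherwise maximality of \<open>I'\<close> would force \<open>I'' = I'\<close>,
      although \<open>y\<close> separates them.\<close>
    have "\<not> I' \<subseteq> I''"
      using rep I''_props y unfolding repair_def by auto
    then have "I' - I'' \<noteq> {}"
      by blast
    moreover have "{y} \<subseteq> I - I'"
      using y I''_props by blast
    moreover have "consistent F ((I' - (I' - I'')) \<union> {y})"
      using I''_props(2) by (rule consistent_subset) (use y in blast)
    moreover have "\<forall>x \<in> I' - I''. \<forall>z \<in> {y}. (z, x) \<in> P"
      using dom by blast
    ultimately have "\<exists>X Y. X \<noteq> {} \<and> X \<subseteq> I' \<and> Y \<noteq> {} \<and> Y \<subseteq> I - I' \<and>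
        (\<forall>x \<in> X. \<forall>z \<in> Y. (z, x) \<in> P) \<and> consistent F ((I' - X) \<union> Y)"
      by (intro exI[of _ "I' - I''"] exI[of _ "{y}"] conjI) auto
    then show False
      using opt unfolding pareto_optimal_def by (elim conjE) (erule notE)
  qed
next
  assume undom: "\<nexists>I''. (I'', I') \<in> pareto_dominates I F P"
  have "False" if XY: "Y \<noteq> {}" "Y \<subseteq> I - I'" "\<forall>x \<in> X. \<forall>y \<in> Y. (y, x) \<in> P"
      and cons: "consistent F ((I' - X) \<union> Y)" for X Y
  proof -
    have "(I' - X) \<union> Y \<subseteq> I"
      using rep XY(2) unfolding repair_def by blast
    then obtain I'' where I'': "(I' - X) \<union> Y \<subseteq> I''" "repair I F I''"
      using consistent_extends_to_repair[OF assms(1) _ cons] by blast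
    obtain y where "y \<in> Y"
      using XY(1) by blast
    \<comment> \<open>Since \<open>I' - X\<close> survives in \<open>I''\<close>, the facts lost
      from \<open>I'\<close> all lie in \<open>X\<close>, where \<open>y\<close> beats each of
      them.\<close>
    then have "y \<in> I'' - I'" "\<forall>x \<in> I' - I''. (y, x) \<in> P"
      using I'' XY(2,3) by blast+
    then have "(I'', I') \<in> pareto_dominates I F P"
      using I'' rep unfolding pareto_dominates_def by blast
    then show False
      using undom by blast
  qed
  moreover have "I' \<subseteq> I"
    using rep unfolding repair_def by blast
  ultimately show "pareto_optimal I F P I'"
    unfolding pareto_optimal_def by (intro conjI notI) (assumption, elim exE conjE)
qed

text \<open>Stated for arbitrary sets: \<open>pareto_dominates\<close> is a subset of this relation,
  and acyclicity passes to subsets.\<close>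

lemma acyclic_exchange_dominance:
  assumes "wf P"
  shows "acyclic {(A, B). \<exists>y \<in> A - B. \<forall>x \<in> B - A. (y, x) \<in> P}" (is "acyclic ?D")
proof (rule acyclicI, rule allI, rule notI)
  fix A assume "(A, A) \<in> ?D\<^sup>+"
  then obtain n where "n > 0" "(A, A) \<in> ?D ^^ n"
    by (auto simp: trancl_power)
  then obtain f where f: "f 0 = A" "f n = A" "\<forall>i<n. (f i, f (Suc i)) \<in> ?D"
    by (auto simp: relpow_fun_conv)
  from f(3) have "\<forall>i \<in> {..<n}. \<exists>y. y \<in> f i - f (Suc i) \<and> (\<forall>x \<in> f (Suc i) - f i. (y, x) \<in> P)"
    by blast
  then obtain y where
    "\<forall>i \<in> {..<n}. y i \<in> f i - f (Suc i) \<and> (\<forall>x \<in> f (Suc i) - f i. (y i, x) \<in> P)"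
    unfolding bchoice_iff by blast
  then have y: "\<And>i. i < n \<Longrightarrow> y i \<in> f i - f (Suc i)"
    and dom: "\<And>i x. i < n \<Longrightarrow> x \<in> f (Suc i) - f i \<Longrightarrow> (y i, x) \<in> P"
    by auto
  \<comment> \<open>As \<open>(w, z) \<in> P\<close> means that \<open>w\<close> beats
    \<open>z\<close>, a minimal element for \<open>P\<close> is an undominated witness.\<close>
  obtain z where "z \<in> y ` {..<n}" and max: "\<And>w. (w, z) \<in> P \<Longrightarrow> w \<notin> y ` {..<n}"
    using wfE_min[OF assms, of "y 0" "y ` {..<n}"] \<open>n > 0\<close> by blast
  then obtain i where i: "i < n" "z = y i"
    by blast
  \<comment> \<open>Regaining \<open>z\<close> in step \<open>j\<close> would put
    \<open>(y j, z)\<close> into \<open>P\<close>.\<close>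
  have lost: "z \<notin> f (Suc j)" if "j < n" "z \<notin> f j" for j
    using that dom max by blast
  have stays_lost: "z \<notin> f k" if "z \<notin> f j" "j \<le> k" "k \<le> n" for j k
    using that(2,3,1) by (induction rule: dec_induct) (simp_all add: lost Suc_le_eq)
  \<comment> \<open>Lost in step \<open>i\<close>, \<open>z\<close> stays absent to the end of the
    cycle; since \<open>f n = f 0\<close>, it is then absent from the start up to
    \<open>f i\<close>, which contains \<open>y i\<close>.\<close>
  have "z \<notin> f n"
    using stays_lost[of "Suc i" n] y i by auto
  then have "z \<notin> f i"
    using stays_lost[of 0 i] f(1,2) i(1) by simp
  then show False
    using y i by blast
qed

theorem proposition7:
  fixes S :: "'r schema"
    and I :: "('r, 'd::infinite) fact set"
    and F :: "('r, 'd) denial set"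
    and P :: "('r, 'd) fact rel"
  assumes "is_schema S"
    and "is_instance S I"
    and "finite F" and "\<forall>c \<in> F. is_denial S c"
    and "priority I F P"
  shows "(\<forall>I'. repair I F I' \<longrightarrow>
            (pareto_optimal I F P I' \<longleftrightarrow>
               \<not> (\<exists>I''. repair I F I'' \<and> I'' \<noteq> I' \<and> (I'', I') \<in> pareto_dominates I F P)))
       \<and> acyclic (pareto_dominates I F P)"
proof -
  have fin: "finite I"
    using assms(2) unfolding is_instance_def by blast
  have "wf P"
    using assms(5) fin unfolding priority_def
    by (meson finite_SigmaI finite_acyclic_wf finite_subset)
  then have acyclic: "acyclic (pareto_dominates I F P)"
    by (rule acyclic_subset[OF acyclic_exchange_dominance])
      (auto simp: pareto_dominates_def)
  \<comment> \<open>The witness in \<open>I'' - I'\<close> already forces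
    \<open>I'' \<noteq> I'\<close>.\<close>
  have "(I'', I') \<in> pareto_dominates I F P \<longleftrightarrow>
      repair I F I'' \<and> I'' \<noteq> I' \<and> (I'', I') \<in> pareto_dominates I F P" for I' I''
    unfolding pareto_dominates_def by blast
  then show ?thesis
    using pareto_optimal_repair_iff[OF fin] acyclic by simp
qed

end
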